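(* Consider the following system of polynomial equations in the noncommuting variables $x,x',y,y',z$: \[xx'=1,\quad yy'=1,\quad yx^2y'=x^3,\quad z\,(yxy'x'yx'y'x-1)=1.\] There exists a division ring in which this system has a solution, but for no field $\mathbb{F}$ and no positive integer $c$ does the system have a solution in $M_c(\mathbb{F})$ (where $1$ is interpreted as the identity matrix).
   Context: The division ring in question can be taken to be any division ring $D_{\mathrm{BS}}$ whose multiplicative group contains the Baumslag--Solitar group $\mathrm{BS}(2,3)=\langle a,b\mid ba^2b^{-1}a^{-3}\rangle$. *)

theory Defs
  imports "Jordan_Normal_Form.Matrix"
begin

text \<open>Division rings, not necessarily commutative, as carrier-based rings (the library's
  \<open>field\<close> locale is commutative, and \<open>division_ring\<close> is already the name of a type class).\<close>

locale skew_field = ring R for R (structure) +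
  assumes one_not_zero: "\<one> \<noteq> \<zero>"
    and skew_field_Units: "Units R = carrier R - {\<zero>}"

definition bs_solution ::
  "('a, 'b) ring_scheme \<Rightarrow> 'a \<Rightarrow> 'a \<Rightarrow> 'a \<Rightarrow> 'a \<Rightarrow> 'a \<Rightarrow> bool"
  where
  "bs_solution R x x' y y' z \<longleftrightarrow>
     x \<in> carrier R \<and> x' \<in> carrier R \<and> y \<in> carrier R \<and> y' \<in> carrier R \<and> z \<in> carrier R \<and>
     x \<otimes>\<^bsub>R\<^esub> x' = \<one>\<^bsub>R\<^esub> \<and>
     y \<otimes>\<^bsub>R\<^esub> y' = \<one>\<^bsub>R\<^esub> \<and>
     y \<otimes>\<^bsub>R\<^esub> x [^]\<^bsub>R\<^esub> (2::nat) \<otimes>\<^bsub>R\<^esub> y' = x [^]\<^bsub>R\<^esub> (3::nat) \<and>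
     z \<otimes>\<^bsub>R\<^esub>
       (y \<otimes>\<^bsub>R\<^esub> x \<otimes>\<^bsub>R\<^esub> y' \<otimes>\<^bsub>R\<^esub> x' \<otimes>\<^bsub>R\<^esub> y \<otimes>\<^bsub>R\<^esub> x' \<otimes>\<^bsub>R\<^esub> y' \<otimes>\<^bsub>R\<^esub> x \<ominus>\<^bsub>R\<^esub> \<one>\<^bsub>R\<^esub>) = \<one>\<^bsub>R\<^esub>"

end

theory Submission
  imports Defs "Jordan_Normal_Form.Determinant" "HOL-Library.Function_Algebras"
    "HOL-Library.Countable_Set"
begin

text \<open>Put \<open>u = y x y\<inverse>\<close>. The relation reads \<open>u\<^sup>2 = x\<^sup>3\<close>, and the last equation forces that \<open>u\<close> and
  \<open>x\<close> do not commute.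

  In a matrix algebra they do commute. As \<open>x\<^bsup>2k\<^esup>\<close> and \<open>x\<^bsup>3k\<^esup>\<close> are conjugate, the dimension of the
  centralizer of \<open>x\<^sup>m\<close>, for \<open>m = 2\<^sup>a 3\<^sup>b\<close>, depends only on \<open>a + b\<close>; it is bounded and grows with
  divisibility of \<open>m\<close>. So for large \<open>n\<close> the powers of \<open>x\<close> with exponents \<open>2\<^sup>n\<close>, \<open>3\<^sup>n\<close> and \<open>6\<^sup>n\<close>
  have the same centralizer, which is that of \<open>x\<close> because \<open>2\<^sup>n\<close> and \<open>3\<^sup>n\<close> are coprime. Hence \<open>u\<close>,
  which commutes with \<open>u\<^sup>2 = x\<^sup>3\<close>, commutes with \<open>x\<close>.

  The division ring is a Malcev-Neumann ring of complex series over a bi-ordered group, with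
  multiplication twisted by a cocycle. The twist provides an element commuting with \<open>x\<^sup>3\<close> but not
  with \<open>x\<close>, which cannot exist without it since roots in a bi-ordered group are unique. The
  countable division subring generated by \<open>x\<close> and \<open>y\<close> can be carried by the natural numbers.\<close>

section \<open>Matrix algebras\<close>

context monoid
begin

definition centralizer :: "'a \<Rightarrow> 'a set" where
  "centralizer g = {a \<in> carrier G. a \<otimes> g = g \<otimes> a}"

lemma centralizer_pow_mono:
  assumes "g \<in> carrier G"
  shows "centralizer g \<subseteq> centralizer (g [^] (k::nat))"
proof
  fix a assume a: "a \<in> centralizer g"
  then have ac: "a \<in> carrier G" "a \<otimes> g = g \<otimes> a" by (auto simp: centralizer_def)
  have "a \<otimes> g [^] k = g [^] k \<otimes> a"
    using ac assms by (induction k) (simp_all add: m_assoc flip: m_assoc, metis m_assoc nat_pow_closed)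
  then show "a \<in> centralizer (g [^] k)" using ac by (auto simp: centralizer_def)
qed

lemma centralizer_dvd_mono:
  assumes "g \<in> carrier G" "m dvd (n::nat)"
  shows "centralizer (g [^] m) \<subseteq> centralizer (g [^] n)"
proof -
  from assms obtain k where "n = m * k" by (elim dvdE)
  then show ?thesis using centralizer_pow_mono[of "g [^] m" k] assms by (simp add: nat_pow_pow)
qed

text \<open>By Bezout, two consecutive powers \<open>x [^] (n * q)\<close> and
  \<open>x [^] (n * q + 1)\<close> commute with \<open>a\<close>; cancelling the unit
  \<open>x [^] (n * q)\<close> leaves \<open>x\<close>.\<close>

lemma centralizer_coprime_powers:
  assumes x: "x \<in> Units G" and m: "m > 0" and cop: "coprime m (n::nat)"
  shows "centralizer (x [^] m) \<inter> centralizer (x [^] n) \<subseteq> centralizer x"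
proof
  fix a assume a: "a \<in> centralizer (x [^] m) \<inter> centralizer (x [^] n)"
  have xc: "x \<in> carrier G" using x by (rule Units_closed)
  have ac: "a \<in> carrier G" using a by (auto simp: centralizer_def)
  obtain p q where pq: "m * p = n * q + 1"
    using bezout_nat[of m n] m cop by (auto simp: coprime_iff_gcd_eq_1)
  have "a \<in> centralizer (x [^] (n * q))" "a \<in> centralizer (x [^] (n * q + 1))"
    using a centralizer_dvd_mono[OF xc, of n "n * q"] centralizer_dvd_mono[OF xc, of m "m * p"]
    unfolding pq[symmetric] by auto
  then have "a \<otimes> x [^] (n * q) = x [^] (n * q) \<otimes> a"
    "a \<otimes> (x [^] (n * q) \<otimes> x) = (x [^] (n * q) \<otimes> x) \<otimes> a"
    by (auto simp: centralizer_def)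
  then have "x [^] (n * q) \<otimes> (a \<otimes> x) = x [^] (n * q) \<otimes> (x \<otimes> a)"
    using ac xc by (metis m_assoc nat_pow_closed)
  moreover have "x [^] k \<in> Units G" for k :: nat using x by (induction k) auto
  ultimately have "a \<otimes> x = x \<otimes> a" using ac xc by simp
  then show "a \<in> centralizer x" using ac by (simp add: centralizer_def)
qed

lemma conj_pow:
  assumes "y \<in> Units G" "g \<in> carrier G"
  shows "(y \<otimes> g \<otimes> inv y) [^] (k::nat) = y \<otimes> g [^] k \<otimes> inv y"
proof (induction k)
  case 0
  then show ?case using assms Units_closed[of y] by simp
next
  case (Suc k)
  have "y \<otimes> g [^] k \<otimes> inv y \<otimes> (y \<otimes> g \<otimes> inv y) = y \<otimes> g [^] k \<otimes> (inv y \<otimes> y) \<otimes> g \<otimes> inv y"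
    using assms Units_closed[of y] by (simp add: m_assoc del: Units_l_inv)
  also have "\<dots> = y \<otimes> (g [^] k \<otimes> g) \<otimes> inv y" using assms Units_closed[of y] by (simp add: m_assoc)
  finally show ?case using Suc by simp
qed

text \<open>The hypotheses on \<open>d\<close> are those properties of the dimension of a centralizer in a matrix
  algebra that the argument uses.\<close>

lemma baumslag_solitar_commute:
  fixes d :: "'a set \<Rightarrow> nat"
  assumes x: "x \<in> Units G" and y: "y \<in> Units G"
    and rel: "y \<otimes> x [^] (2::nat) \<otimes> inv y = x [^] (3::nat)"
    and d_mono: "\<And>g h. g \<in> carrier G \<Longrightarrow> h \<in> carrier G \<Longrightarrow> centralizer g \<subseteq> centralizer h \<Longrightarrow>
      d (centralizer g) \<le> d (centralizer h)"
    and d_eq: "\<And>g h. g \<in> carrier G \<Longrightarrow> h \<in> carrier G \<Longrightarrow> centralizer g \<subseteq> centralizer h \<Longrightarrow>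
      d (centralizer g) = d (centralizer h) \<Longrightarrow> centralizer g = centralizer h"
    and d_bound: "\<And>g. g \<in> carrier G \<Longrightarrow> d (centralizer g) \<le> N"
    and d_conj: "\<And>g. g \<in> carrier G \<Longrightarrow> d (centralizer (y \<otimes> g \<otimes> inv y)) = d (centralizer g)"
  shows "(y \<otimes> x \<otimes> inv y) \<otimes> x = x \<otimes> (y \<otimes> x \<otimes> inv y)"
proof -
  have xc: "x \<in> carrier G" and yc: "y \<in> carrier G" using x y by (auto intro: Units_closed)
  define D where "D k = d (centralizer (x [^] (k::nat)))" for k
  have D_mono: "D m \<le> D n" if "m dvd n" for m n
    unfolding D_def using centralizer_dvd_mono[OF xc that] xc by (intro d_mono) auto
  \<comment> \<open>By the relation, \<open>x [^] (3 * k)\<close> is the conjugate of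
    \<open>x [^] (2 * k)\<close> by \<open>y\<close>.\<close>
  have D23: "D (2 * k) = D (3 * k)" for k
  proof -
    have "x [^] (3 * k) = y \<otimes> x [^] (2 * k) \<otimes> inv y"
      using conj_pow[OF y, of "x [^] (2::nat)" k] rel xc by (simp add: nat_pow_pow)
    then show ?thesis unfolding D_def using d_conj[of "x [^] (2 * k)"] xc by simp
  qed
  have D_homog: "D (2 ^ a * 3 ^ b) = D (2 ^ (a + b))" for a b
  proof (induction b arbitrary: a)
    case (Suc b)
    have "D (2 ^ a * 3 ^ Suc b) = D (3 * (2 ^ a * 3 ^ b))" by (simp add: mult_ac)
    also have "\<dots> = D (2 ^ Suc a * 3 ^ b)" by (subst D23[symmetric]) (simp add: mult_ac)
    finally show ?case using Suc[of "Suc a"] by simp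
  qed simp
  define E where "E n = D (2 ^ n)" for n
  have E_mono: "E m \<le> E n" if "m \<le> n" for m n
    unfolding E_def using that by (intro D_mono le_imp_power_dvd)
  have "finite (range E)"
  proof (rule finite_subset)
    show "range E \<subseteq> {..N}" using d_bound xc by (auto simp: E_def D_def)
  qed simp
  then have "Max (range E) \<in> range E" by (intro Max_in) auto
  then obtain n0 where n0: "E n0 = Max (range E)" by auto
  \<comment> \<open>\<open>E\<close> is constant from \<open>n0\<close> on; the successor makes
    \<open>n\<close> positive, so that 3 divides \<open>6 ^ n\<close> below.\<close>
  define n where "n = Suc n0"
  have stable: "E m = E n" if "m \<ge> n" for m
  proof -
    have "E k \<le> E n0" for k unfolding n0 using \<open>finite (range E)\<close> by (intro Max_ge) auto
    moreover have "E n0 \<le> E n" "E n \<le> E m" using that by (auto intro!: E_mono simp: n_def)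
    ultimately show ?thesis using le_antisym by metis
  qed
  have six: "(6::nat) ^ n = 2 ^ n * 3 ^ n" by (simp flip: power_mult_distrib)
  \<comment> \<open>Trading each factor 3 for a factor 2 turns \<open>D (6 ^ n)\<close> into
    \<open>E (n + n)\<close>, which already has the stable value.\<close>
  have D6: "D (6 ^ n) = E n" using D_homog[of n n] stable[of "n + n"] by (simp add: E_def six)
  have "D (2 ^ n) = E n" "D (3 ^ n) = E n" using D_homog[of 0 n] by (simp_all add: E_def)
  then have "centralizer (x [^] ((2::nat) ^ n)) = centralizer (x [^] ((6::nat) ^ n))"
    "centralizer (x [^] ((3::nat) ^ n)) = centralizer (x [^] ((6::nat) ^ n))"
    using D6 xc by (intro d_eq centralizer_dvd_mono; simp add: D_def six)+
  moreover have "coprime ((2::nat) ^ n) (3 ^ n)" by simp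
  ultimately have "centralizer (x [^] ((6::nat) ^ n)) \<subseteq> centralizer x"
    using centralizer_coprime_powers[OF x, of "2 ^ n" "3 ^ n"] by auto
  moreover have "centralizer (x [^] (3::nat)) \<subseteq> centralizer (x [^] ((6::nat) ^ n))"
    by (rule centralizer_dvd_mono[OF xc]) (simp add: n_def)
  moreover have "y \<otimes> x \<otimes> inv y \<in> centralizer (x [^] (3::nat))"
  proof -
    have "x [^] (3::nat) = (y \<otimes> x \<otimes> inv y) [^] (2::nat)"
      using conj_pow[OF y xc, of 2] rel by simp
    moreover have "y \<otimes> x \<otimes> inv y \<in> centralizer (y \<otimes> x \<otimes> inv y)"
      using xc yc y by (simp add: centralizer_def)
    ultimately show ?thesis
      using centralizer_pow_mono[of "y \<otimes> x \<otimes> inv y" 2] xc yc y by auto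
  qed
  ultimately show ?thesis by (auto simp: centralizer_def)
qed

end

section \<open>Dimensions inside a finite span\<close>

text \<open>A vector of \<open>W\<close> outside \<open>V\<close> would extend a basis of
  \<open>V\<close> to an independent set of more than \<open>dim W\<close> vectors. The finite set
  \<open>T\<close> bounds dimensions, as the ambient space may be infinite-dimensional.\<close>

lemma (in vector_space) subspace_eq_of_dim_eq:
  assumes "subspace V" "V \<subseteq> W" "W \<subseteq> span T" "finite T" "dim V = dim W"
  shows "V = W"
proof (rule ccontr)
  assume "V \<noteq> W"
  with assms obtain w where w: "w \<in> W" "w \<notin> V" by auto
  obtain B where B: "B \<subseteq> V" "independent B" "V \<subseteq> span B" "card B = dim V" by (rule basis_exists)
  obtain B' where B': "B' \<subseteq> W" "independent B'" "W \<subseteq> span B'" "card B' = dim W" by (rule basis_exists)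
  have "span B \<subseteq> V" using B assms by (simp add: span_minimal)
  then have "w \<notin> span B" using w by auto
  then have ind: "independent (insert w B)" using B by (simp add: independent_insert)
  have fin: "finite B'" "finite B"
    using independent_span_bound[OF \<open>finite T\<close>] B B' assms by (meson order_trans)+
  have "card (insert w B) \<le> card B'"
    using independent_span_bound[OF fin(1) ind] w B B' assms by (meson insert_subset order_trans subsetD)
  moreover have "w \<notin> B" using w B by auto
  ultimately show False using fin B B' assms by simp
qed

lemma (in vector_space) dim_le_of_subset_span:
  assumes "V \<subseteq> W" "W \<subseteq> span T" "finite T"
  shows "dim V \<le> dim W"
proof -
  obtain B' where B': "B' \<subseteq> W" "independent B'" "W \<subseteq> span B'" "card B' = dim W" by (rule basis_exists)
  have "finite B'" using independent_span_bound[OF \<open>finite T\<close> B'(2)] B' assms by auto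
  then show ?thesis using dim_le_card[of V B'] B' assms by auto
qed


lemma (in vector_space) dim_image_le_of_subset_span:
  assumes "Vector_Spaces.linear scale scale f" "V \<subseteq> span T" "finite T"
  shows "dim (f ` V) \<le> dim V"
proof -
  interpret Vector_Spaces.linear scale scale f by fact
  obtain B where B: "B \<subseteq> V" "independent B" "V \<subseteq> span B" "card B = dim V" by (rule basis_exists)
  have fin: "finite B" using independent_span_bound[OF \<open>finite T\<close> B(2)] B assms by auto
  have "f ` V \<subseteq> span (f ` B)" using B by (auto simp: span_image)
  then have "dim (f ` V) \<le> card (f ` B)" using fin by (intro dim_le_card) auto
  also have "\<dots> \<le> card B" using fin by (rule card_image_le)
  finally show ?thesis using B by simp
qed

section \<open>No solution in matrices\<close>

text \<open>Matrices of all sizes share one type, which is not a vector space, while functions on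
  index pairs form one. The default 0 makes the map linear on matrices of a fixed size.\<close>

definition entries :: "'a::zero mat \<Rightarrow> nat \<times> nat \<Rightarrow> 'a" where
  "entries A = (\<lambda>p. if fst p < dim_row A \<and> snd p < dim_col A then A $$ p else 0)"

lemma mat_entries: "A \<in> carrier_mat m n \<Longrightarrow> mat m n (entries A) = A"
  by (rule eq_matI) (auto simp: entries_def)

lemma entries_inject:
  "A \<in> carrier_mat m n \<Longrightarrow> B \<in> carrier_mat m n \<Longrightarrow> entries A = entries B \<longleftrightarrow> A = B"
  by (metis mat_entries)

lemma sum_fun_apply: "(\<Sum>p\<in>S. F p) q = (\<Sum>p\<in>S. F p q :: 'a::comm_monoid_add)"
  by (induction S rule: infinite_finite_induct) auto

lemma vector_space_fun: "vector_space (\<lambda>(a::'a::field) (f::'b \<Rightarrow> 'a) p. a * f p)"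
  by unfold_locales (auto simp: algebra_simps fun_eq_iff)

text \<open>With \<open>d\<close> the dimension of the centralizer,
  \<open>baumslag_solitar_commute\<close> makes \<open>y * x * y'\<close> commute with
  \<open>x\<close>. The word in the last equation is then 1, and the equation reads
  \<open>z * 0 = 1\<close>.\<close>

theorem no_solution_ring_mat:
  fixes x :: "'f::field mat"
  assumes "c > 0"
  shows "\<not> bs_solution (ring_mat TYPE('f) c ()) x x' y y' z"
proof
  let ?R = "ring_mat TYPE('f) c ()"
  let ?M = "carrier_mat c c :: 'f mat set"
  assume sol: "bs_solution ?R x x' y y' z"
  interpret R: ring ?R by (rule ring_mat)
  note simps = ring_mat_simps
  have carr: "x \<in> ?M" "x' \<in> ?M" "y \<in> ?M" "y' \<in> ?M" "z \<in> ?M"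
    and xx': "x * x' = 1\<^sub>m c" and yy': "y * y' = 1\<^sub>m c"
    and rel: "y \<otimes>\<^bsub>?R\<^esub> x [^]\<^bsub>?R\<^esub> (2::nat) \<otimes>\<^bsub>?R\<^esub> y' = x [^]\<^bsub>?R\<^esub> (3::nat)"
    and z: "z * (y * x * y' * x' * y * x' * y' * x \<ominus>\<^bsub>?R\<^esub> 1\<^sub>m c) = 1\<^sub>m c"
    using sol by (auto simp: bs_solution_def simps)
  have x'x: "x' * x = 1\<^sub>m c" and y'y: "y' * y = 1\<^sub>m c"
    using carr xx' yy' by (auto intro: mat_mult_left_right_inverse)
  have xU: "x \<in> Units ?R" and yU: "y \<in> Units ?R"
    using carr xx' x'x yy' y'y by (auto simp: Units_def simps)
  have inv_y: "inv\<^bsub>?R\<^esub> y = y'" using carr yy' y'y by (intro R.inv_char) (auto simp: simps)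

  interpret V: vector_space "\<lambda>(a::'f) (f::nat \<times> nat \<Rightarrow> 'f) p. a * f p" by (rule vector_space_fun)
  \<comment> \<open>The entry functions of the matrix units.\<close>
  define T where "T = (\<lambda>p q. if q = p then 1 else 0 :: 'f) ` ({..<c} \<times> {..<c})"
  have finT: "finite T" by (simp add: T_def)
  have spanT: "entries A \<in> V.span T" if "A \<in> ?M" for A
  proof -
    have "entries A = (\<Sum>p\<in>{..<c} \<times> {..<c}. (\<lambda>q. A $$ p * (if q = p then 1 else 0)))"
      using that by (auto simp: fun_eq_iff entries_def sum_fun_apply if_distrib cong: if_cong)
    moreover have "(\<lambda>q. A $$ p * (if q = p then 1 else 0)) \<in> V.span T" if "p \<in> {..<c} \<times> {..<c}" for p
      using that by (intro V.span_scale V.span_base) (auto simp: T_def)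
    ultimately show ?thesis by (simp only: V.span_sum)
  qed
  have cent_sub: "R.centralizer g \<subseteq> ?M" for g by (auto simp: R.centralizer_def simps)
  have cent_span: "entries ` R.centralizer g \<subseteq> V.span T" for g
    using cent_sub[of g] spanT by auto
  have cent_subspace: "V.subspace (entries ` R.centralizer g)" if g: "g \<in> ?M" for g
  proof (rule V.subspaceI)
    show "0 \<in> entries ` R.centralizer g"
      using g by (intro image_eqI[of _ _ "0\<^sub>m c c"]) (auto simp: entries_def R.centralizer_def simps fun_eq_iff)
  next
    fix f h assume "f \<in> entries ` R.centralizer g" "h \<in> entries ` R.centralizer g"
    then obtain A B where AB: "A \<in> R.centralizer g" "B \<in> R.centralizer g" "f = entries A" "h = entries B"
      by auto
    then show "f + h \<in> entries ` R.centralizer g"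
      using g by (intro image_eqI[of _ _ "A + B"])
        (auto simp: entries_def R.centralizer_def simps fun_eq_iff
            add_mult_distrib_mat[of _ c c _ _ c] mult_add_distrib_mat[of _ c c _ c])
  next
    fix a f assume "f \<in> entries ` R.centralizer g"
    then obtain A where A: "A \<in> R.centralizer g" "f = entries A" by auto
    then show "(\<lambda>p. a * f p) \<in> entries ` R.centralizer g"
      using g by (intro image_eqI[of _ _ "a \<cdot>\<^sub>m A"])
        (auto simp: entries_def R.centralizer_def simps fun_eq_iff
            mult_smult_distrib[of _ c c _ c] mult_smult_assoc_mat[of _ c c _ c])
  qed
  define d where "d S = V.dim (entries ` S)" for S
  have d_conj_le: "d (R.centralizer (u * g * u')) \<le> d (R.centralizer g)"
    if g: "g \<in> ?M" and u: "u \<in> ?M" "u' \<in> ?M" "u * u' = 1\<^sub>m c" "u' * u = 1\<^sub>m c" for g u u'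
  proof -
    \<comment> \<open>Conjugation by \<open>u\<close>, read on arbitrary functions through
      \<open>mat c c\<close> so that it is linear on the whole space.\<close>
    define L where "L f = entries (u * mat c c f * u')" for f
    have lin: "Vector_Spaces.linear (\<lambda>(a::'f) f p. a * f p) (\<lambda>a f p. a * f p) L"
    proof
      fix f h :: "nat \<times> nat \<Rightarrow> 'f"
      have "mat c c (f + h) = mat c c f + mat c c h" by (rule eq_matI) auto
      then have "u * mat c c (f + h) * u' = u * mat c c f * u' + u * mat c c h * u'"
        using u by (simp add: add_mult_distrib_mat[of _ c c _ _ c] mult_add_distrib_mat[of _ c c _ c])
      then show "L (f + h) = L f + L h" using u by (auto simp: L_def entries_def fun_eq_iff)
    next
      fix a and f :: "nat \<times> nat \<Rightarrow> 'f"
      have "mat c c (\<lambda>p. a * f p) = a \<cdot>\<^sub>m mat c c f" by (rule eq_matI) auto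
      then have "u * mat c c (\<lambda>p. a * f p) * u' = a \<cdot>\<^sub>m (u * mat c c f * u')"
        using u by (simp add: mult_smult_distrib[of _ c c _ c] mult_smult_assoc_mat[of _ c c _ c])
      then show "L (\<lambda>p. a * f p) = (\<lambda>p. a * L f p)" using u by (auto simp: L_def entries_def fun_eq_iff)
    qed
    have "entries ` R.centralizer (u * g * u') \<subseteq> L ` entries ` R.centralizer g"
    proof (clarify)
      fix A assume A: "A \<in> R.centralizer (u * g * u')"
      then have AM: "A \<in> ?M" and comm: "A * (u * g * u') = (u * g * u') * A"
        by (auto simp: R.centralizer_def simps)
      note as = assoc_mult_mat[of _ c c _ c _ c]
      have uu: "u * (u' * B) = B" "u' * (u * B) = B" if "B \<in> ?M" for B
        using that u by (simp_all flip: as)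
      have "u' * (A * (u * g * u')) * u = u' * ((u * g * u') * A) * u" using comm by simp
      then have "u' * A * u \<in> R.centralizer g"
        using AM u g by (simp add: R.centralizer_def simps as uu)
      moreover have "u * (u' * A * u) * u' = A" using AM u by (simp add: as uu)
      ultimately show "entries A \<in> L ` entries ` R.centralizer g"
        using AM u by (intro image_eqI[of _ _ "entries (u' * A * u)"]) (auto simp: L_def mat_entries)
    qed
    moreover have "L ` entries ` R.centralizer g \<subseteq> V.span T"
      using u by (auto simp: L_def intro!: spanT)
    ultimately have "d (R.centralizer (u * g * u')) \<le> V.dim (L ` entries ` R.centralizer g)"
      unfolding d_def using finT by (rule V.dim_le_of_subset_span)
    also have "\<dots> \<le> d (R.centralizer g)"
      unfolding d_def using lin cent_span finT by (rule V.dim_image_le_of_subset_span)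
    finally show ?thesis .
  qed
  have d_conj: "d (R.centralizer (y * g * y')) = d (R.centralizer g)" if g: "g \<in> ?M" for g
  proof (rule antisym)
    have "y' * (y * g * y') * y = (y' * y) * g * (y' * y)"
      using carr g by (simp add: assoc_mult_mat[of _ c c _ c _ c])
    then show "d (R.centralizer g) \<le> d (R.centralizer (y * g * y'))"
      using d_conj_le[of "y * g * y'" y' y] carr g yy' y'y by simp
  qed (use d_conj_le g carr yy' y'y in auto)
  have "(y \<otimes>\<^bsub>?R\<^esub> x \<otimes>\<^bsub>?R\<^esub> inv\<^bsub>?R\<^esub> y) \<otimes>\<^bsub>?R\<^esub> x = x \<otimes>\<^bsub>?R\<^esub> (y \<otimes>\<^bsub>?R\<^esub> x \<otimes>\<^bsub>?R\<^esub> inv\<^bsub>?R\<^esub> y)"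
  proof (rule R.baumslag_solitar_commute[OF xU yU, where d = d and N = "card T"])
    show "y \<otimes>\<^bsub>?R\<^esub> x [^]\<^bsub>?R\<^esub> (2::nat) \<otimes>\<^bsub>?R\<^esub> inv\<^bsub>?R\<^esub> y = x [^]\<^bsub>?R\<^esub> (3::nat)"
      using rel by (simp add: inv_y)
    show "d (R.centralizer g) \<le> d (R.centralizer h)"
      if "R.centralizer g \<subseteq> R.centralizer h" for g h
      unfolding d_def using that cent_span finT by (intro V.dim_le_of_subset_span) auto
    show "R.centralizer g = R.centralizer h"
      if "g \<in> carrier ?R" "R.centralizer g \<subseteq> R.centralizer h" "d (R.centralizer g) = d (R.centralizer h)" for g h
    proof -
      have "entries ` R.centralizer g = entries ` R.centralizer h"
        using that cent_span finT cent_subspace[of g] unfolding d_def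
        by (intro V.subspace_eq_of_dim_eq[of _ _ T]) (auto simp: simps)
      moreover have "inj_on entries ?M" by (auto simp: inj_on_def entries_inject)
      ultimately show ?thesis using cent_sub by (metis inj_on_image_eq_iff)
    qed
    show "d (R.centralizer g) \<le> card T" for g
      unfolding d_def using cent_span finT by (rule V.dim_le_card)
    show "d (R.centralizer (y \<otimes>\<^bsub>?R\<^esub> g \<otimes>\<^bsub>?R\<^esub> inv\<^bsub>?R\<^esub> y)) = d (R.centralizer g)" if "g \<in> carrier ?R" for g
      using d_conj[of g] that by (simp add: simps inv_y)
  qed
  then have comm: "y * x * y' * x = x * (y * x * y')" by (simp add: simps inv_y)
  note as = assoc_mult_mat[of _ c c _ c _ c]
  define w where "w = y * x * y'"
  define w' where "w' = y * x' * y'"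
  have w: "w \<in> ?M" "w' \<in> ?M" using carr by (auto simp: w_def w'_def)
  have cancel: "x * (x' * B) = B" "x' * (x * B) = B" "y * (y' * B) = B" "y' * (y * B) = B"
    if "B \<in> ?M" for B
    using that carr xx' x'x yy' y'y by (simp_all flip: as)
  have ww': "w * w' = 1\<^sub>m c" using carr yy' by (simp add: w_def w'_def as cancel)
  have "x' * (w * x) * x' = x' * (x * w) * x'" using comm by (simp add: w_def)
  then have wx': "w * x' = x' * w" using carr w xx' by (simp add: as cancel)
  \<comment> \<open>The word is the commutator of \<open>w\<close> and \<open>x'\<close>.\<close>
  have "y * x * y' * x' * y * x' * y' * x = (w * x') * w' * x"
    using carr by (simp add: w_def w'_def as)
  also have "\<dots> = x' * (w * w') * x" unfolding wx' using carr w by (simp add: as)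
  also have "\<dots> = 1\<^sub>m c" using carr ww' x'x by simp
  finally have "z * (1\<^sub>m c \<ominus>\<^bsub>?R\<^esub> 1\<^sub>m c) = 1\<^sub>m c" using z by simp
  moreover have "1\<^sub>m c \<ominus>\<^bsub>?R\<^esub> 1\<^sub>m c = 0\<^sub>m c c"
    using R.r_neg[OF R.one_closed] by (simp add: a_minus_def simps)
  ultimately have "0\<^sub>m c c = (1\<^sub>m c :: 'f mat)" using carr by simp
  then have "(0\<^sub>m c c :: 'f mat) $$ (0, 0) = 1\<^sub>m c $$ (0, 0)" by simp
  then show False using \<open>c > 0\<close> by simp
qed

section \<open>Well-ordered subsets of bi-ordered groups\<close>

text \<open>The notation is additive, but commutativity is not assumed; hence invariance on both
  sides.\<close>

class bi_ordered_group = group_add + linorder +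
  assumes add_less_left: "a < b \<Longrightarrow> c + a < c + b"
    and add_less_right: "a < b \<Longrightarrow> a + c < b + c"
begin

lemma add_le_mono_both: "a \<le> a' \<Longrightarrow> b \<le> b' \<Longrightarrow> a + b \<le> a' + b'"
  using add_less_left[of b b' a] add_less_right[of a a' b'] by (auto simp: le_less intro: less_trans)

lemma decomposition_antimono: "a + b = a' + b' \<Longrightarrow> a < a' \<Longrightarrow> b' < b"
  using add_less_right[of a a' b] add_le_mono_both[of a' a' b b'] by (auto simp: not_le[symmetric])

end

definition well_ordered :: "'a::linorder set \<Rightarrow> bool" where
  "well_ordered S \<longleftrightarrow> (\<forall>T\<subseteq>S. T \<noteq> {} \<longrightarrow> (\<exists>m\<in>T. \<forall>t\<in>T. m \<le> t))"

lemma well_ordered_subset: "well_ordered S \<Longrightarrow> T \<subseteq> S \<Longrightarrow> well_ordered T"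
  by (auto simp: well_ordered_def)

lemma well_ordered_min:
  assumes "well_ordered S" "S \<noteq> {}"
  obtains m where "m \<in> S" "\<And>s. s \<in> S \<Longrightarrow> m \<le> s"
  using assms(1)[unfolded well_ordered_def, rule_format, OF order_refl assms(2)] that by blast

lemma well_ordered_finite:
  assumes "finite S"
  shows "well_ordered S"
  unfolding well_ordered_def
proof (intro allI impI)
  fix T assume T: "T \<subseteq> S" "T \<noteq> {}"
  then have "finite T" using assms finite_subset by blast
  then show "\<exists>m\<in>T. \<forall>t\<in>T. m \<le> t" using T by (intro bexI[of _ "Min T"]) auto
qed

lemma well_ordered_Un:
  assumes "well_ordered A" "well_ordered B"
  shows "well_ordered (A \<union> B)"
  unfolding well_ordered_def
proof (intro allI impI)
  fix T assume T: "T \<subseteq> A \<union> B" "T \<noteq> {}"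
  have min: "\<exists>m\<in>T \<inter> S. \<forall>t\<in>T \<inter> S. m \<le> t" if "well_ordered S" "T \<inter> S \<noteq> {}" for S
    using that by (auto simp: well_ordered_def)
  show "\<exists>m\<in>T. \<forall>t\<in>T. m \<le> t"
  proof (cases "T \<inter> A = {} \<or> T \<inter> B = {}")
    case True
    then show ?thesis using min[OF assms(1)] min[OF assms(2)] T by blast
  next
    case False
    then obtain a b where ab: "a \<in> T" "\<forall>t\<in>T \<inter> A. a \<le> t" "b \<in> T" "\<forall>t\<in>T \<inter> B. b \<le> t"
      using min[OF assms(1)] min[OF assms(2)] by auto
    have "min a b \<le> t" if "t \<in> T" for t
      using that T ab by (auto simp: min_le_iff_disj)
    moreover have "min a b \<in> T" using ab by (simp add: min_def)
    ultimately show ?thesis by blast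
  qed
qed

lemma descending_less:
  fixes f :: "nat \<Rightarrow> 'a::order"
  assumes "\<And>n. f (Suc n) < f n" "m < n"
  shows "f n < f m"
  using assms(2) by (induction rule: less_Suc_induct) (simp add: assms(1), metis less_trans)

lemma well_ordered_no_descending:
  assumes "well_ordered S" "\<And>n::nat. f n \<in> S"
  shows "\<not> (\<forall>n. f (Suc n) < f n)"
proof
  assume desc: "\<forall>n. f (Suc n) < f n"
  obtain m where "m \<in> range f" "\<And>t. t \<in> range f \<Longrightarrow> m \<le> t"
    by (rule well_ordered_min[OF well_ordered_subset[OF assms(1), of "range f"]]) (use assms(2) in auto)
  then show False using desc by (metis leD rangeE rangeI)
qed

lemma well_orderedI:
  assumes "\<And>f::nat \<Rightarrow> 'a::linorder. (\<And>n. f n \<in> S) \<Longrightarrow> (\<And>n. f (Suc n) < f n) \<Longrightarrow> False"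
  shows "well_ordered S"
  unfolding well_ordered_def
proof (intro allI impI, rule ccontr)
  fix T assume T: "T \<subseteq> S" "T \<noteq> {}" "\<not> (\<exists>m\<in>T. \<forall>t\<in>T. m \<le> t)"
  have "\<exists>f. \<forall>n. f n \<in> T \<and> f (Suc n) < f n"
    by (rule dependent_nat_choice[where P = "\<lambda>_ x. x \<in> T" and Q = "\<lambda>_ x y. y < x"])
      (use T in \<open>auto simp: not_le\<close>)
  then show False using assms T by blast
qed

text \<open>Every sequence has a monotone subsequence; a decreasing one reaches its least value and
  is constant from there on.\<close>

lemma well_ordered_incseq_subseq:
  fixes f :: "nat \<Rightarrow> 'a::linorder"
  assumes "well_ordered S" "\<And>n. f n \<in> S"
  obtains r :: "nat \<Rightarrow> nat" where "strict_mono r" "incseq (\<lambda>n. f (r n))"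
proof -
  obtain r :: "nat \<Rightarrow> nat" where r: "strict_mono r" "monoseq (\<lambda>n. f (r n))" using seq_monosub[of f] by auto
  then consider "\<forall>m. \<forall>n\<ge>m. f (r m) \<le> f (r n)" | "\<forall>m. \<forall>n\<ge>m. f (r n) \<le> f (r m)"
    by (auto simp: monoseq_def)
  then show thesis
  proof cases
    case 1
    then show thesis using r that by (auto simp: incseq_def)
  next
    case 2
    have "well_ordered (range (\<lambda>n. f (r n)))" using assms by (auto intro: well_ordered_subset)
    then obtain k where k: "\<And>n. f (r k) \<le> f (r n)" by (rule well_ordered_min) auto
    then have "f (r (n + k)) = f (r k)" for n using 2 by (simp add: antisym)
    moreover have "strict_mono (\<lambda>n. r (n + k))" using r by (auto simp: strict_mono_def)
    ultimately show thesis using that[of "\<lambda>n. r (n + k)"] by (simp add: incseq_def)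
  qed
qed

definition sumset :: "'a::plus set \<Rightarrow> 'a set \<Rightarrow> 'a set" where
  "sumset A B = {a + b | a b. a \<in> A \<and> b \<in> B}"

text \<open>Along a common subsequence both summands increase weakly, so the sums cannot
  descend.\<close>

lemma well_ordered_sumset:
  fixes A B :: "'a::bi_ordered_group set"
  assumes "well_ordered A" "well_ordered B"
  shows "well_ordered (sumset A B)"
proof (rule well_orderedI)
  fix f :: "nat \<Rightarrow> 'a" assume "\<And>n. f n \<in> sumset A B" and desc: "\<And>n. f (Suc n) < f n"
  then have "\<forall>n. \<exists>a b. a \<in> A \<and> b \<in> B \<and> f n = a + b" unfolding sumset_def by blast
  then obtain a b where ab: "\<And>n. a n \<in> A" "\<And>n. b n \<in> B" "\<And>n. f n = a n + b n" by metis
  obtain r :: "nat \<Rightarrow> nat" where r: "strict_mono r" "incseq (\<lambda>n. a (r n))"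
    using well_ordered_incseq_subseq[OF assms(1) ab(1)] .
  obtain q :: "nat \<Rightarrow> nat" where q: "strict_mono q" "incseq (\<lambda>n. b (r (q n)))"
    using well_ordered_incseq_subseq[OF assms(2), of "\<lambda>n. b (r n)"] ab(2) by auto
  have "f (r (q 0)) \<le> f (r (q 1))"
    using r q by (auto simp: ab(3) incseq_def strict_mono_less_eq intro!: add_le_mono_both)
  moreover have "r (q 0) < r (q 1)" using r q by (simp add: strict_mono_def)
  then have "f (r (q 1)) < f (r (q 0))" using descending_less[of f, OF desc] by blast
  ultimately show False by simp
qed

definition decompositions :: "'a::plus set \<Rightarrow> 'a set \<Rightarrow> 'a \<Rightarrow> ('a \<times> 'a) set" where
  "decompositions A B c = {(a, b). a \<in> A \<and> b \<in> B \<and> a + b = c}"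

text \<open>Among infinitely many pairs some sequence has strictly increasing first entries; as the
  sum is fixed, the second entries descend.\<close>

lemma finite_decompositions:
  fixes A B :: "'a::bi_ordered_group set"
  assumes "well_ordered A" "well_ordered B"
  shows "finite (decompositions A B c)"
proof (rule ccontr)
  assume "infinite (decompositions A B c)"
  then obtain p :: "nat \<Rightarrow> 'a \<times> 'a" where p: "inj p" "range p \<subseteq> decompositions A B c"
    using infinite_countable_subset by blast
  have pP: "fst (p n) \<in> A" "snd (p n) \<in> B" "fst (p n) + snd (p n) = c" for n
    using p(2) by (auto simp: decompositions_def case_prod_unfold)
  obtain r :: "nat \<Rightarrow> nat" where r: "strict_mono r" "incseq (\<lambda>n. fst (p (r n)))"
    using well_ordered_incseq_subseq[OF assms(1), of "\<lambda>n. fst (p n)"] pP by auto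
  have "fst (p (r n)) \<noteq> fst (p (r (Suc n)))" for n
  proof
    assume eq: "fst (p (r n)) = fst (p (r (Suc n)))"
    then have "snd (p (r n)) = snd (p (r (Suc n)))" using pP(3) by (metis add_left_cancel)
    with eq have "p (r n) = p (r (Suc n))" by (rule prod_eqI)
    then have "r n = r (Suc n)" using p(1) by (simp add: inj_eq)
    then show False using r(1) by (metis lessI less_irrefl strict_monoD)
  qed
  then have "fst (p (r n)) < fst (p (r (Suc n)))" for n using r(2) by (simp add: incseq_Suc_iff order.not_eq_order_implies_strict)
  then have "snd (p (r (Suc n))) < snd (p (r n))" for n using pP(3) by (metis decomposition_antimono)
  then show False using well_ordered_no_descending[OF assms(2), of "\<lambda>n. snd (p (r n))"] pP by auto
qed

text \<open>Neumann's lemma. Nash-Williams' minimal bad sequence argument needs no Higman ordering here: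
  along a descending sequence of sums whose first letters increase, the sums of the tails descend.\<close>

lemma well_ordered_sum_lists:
  fixes S :: "'a::bi_ordered_group set"
  assumes S: "well_ordered S" and pos: "\<And>a. a \<in> S \<Longrightarrow> 0 < a"
  shows "well_ordered (sum_list ` lists S)"
proof (rule well_orderedI)
  let ?M = "sum_list ` lists S"
  fix f :: "nat \<Rightarrow> 'a" assume fM: "\<And>n. f n \<in> ?M" and f: "\<And>n. f (Suc n) < f n"
  define bad where "bad w \<longleftrightarrow> w \<in> lists S \<and>
    (\<exists>g::nat \<Rightarrow> 'a. g 0 = sum_list w \<and> (\<forall>n. g n \<in> ?M \<and> g (Suc n) < g n))" for w
  have step: "\<exists>v. bad v \<and> sum_list v < sum_list w" if bad_w: "bad w" for w
  proof -
    obtain g :: "nat \<Rightarrow> 'a" where g: "g 0 = sum_list w" "\<And>n. g n \<in> ?M" "\<And>n. g (Suc n) < g n"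
      using bad_w unfolding bad_def by blast
    obtain v where "v \<in> lists S" "g 1 = sum_list v" using g(2)[of 1] by blast
    moreover have "sum_list v < sum_list w" using g(1) g(3)[of 0] calculation by simp
    moreover have "bad v"
      unfolding bad_def using calculation g by (intro conjI exI[of _ "\<lambda>n. g (Suc n)"]) auto
    ultimately show ?thesis by blast
  qed
  \<comment> \<open>Each list of the minimal bad sequence is a shortest bad one with sum below that
    of its predecessor.\<close>
  define next_min where "next_min w v \<longleftrightarrow> bad v \<and> sum_list v < sum_list w \<and>
    (\<forall>v'. bad v' \<and> sum_list v' < sum_list w \<longrightarrow> length v \<le> length v')" for w v
  have next_min: "\<exists>v. next_min w v" if "bad w" for w
    using ex_has_least_nat[of "\<lambda>v. bad v \<and> sum_list v < sum_list w" _ length] step[OF that]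
    unfolding next_min_def by blast
  obtain w0 where "w0 \<in> lists S" "f 0 = sum_list w0" using fM[of 0] by auto
  then have "bad w0" unfolding bad_def using fM f by blast
  then have "\<exists>w. \<forall>n. bad (w n) \<and> next_min (w n) (w (Suc n))"
    by (intro dependent_nat_choice) (use next_min in \<open>auto simp: next_min_def\<close>)
  then obtain w where w: "\<And>n. bad (w n)" "\<And>n. next_min (w n) (w (Suc n))" by auto
  have nonneg: "0 \<le> sum_list v" if "v \<in> lists S" for v
    using that
  proof (induction v)
    case (Cons a v)
    then show ?case using add_le_mono_both[of 0 a 0 "sum_list v"] pos[of a] by auto
  qed simp
  have desc: "sum_list (w n) < sum_list (w m)" if "m < n" for m n
    by (rule descending_less[OF _ that, of "\<lambda>n. sum_list (w n)"]) (use w in \<open>auto simp: next_min_def\<close>)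
  have "w n \<noteq> []" for n
    using desc[of n "Suc n"] nonneg[of "w (Suc n)"] w(1)[of "Suc n"] by (auto simp: bad_def)
  then have "\<forall>n. \<exists>a v. w n = a # v" by (auto simp: neq_Nil_conv)
  then obtain a v where av: "\<And>n. w n = a n # v n" by metis
  have aS: "a n \<in> S" and vS: "v n \<in> lists S" for n using w(1)[of n] av[of n] by (auto simp: bad_def)
  obtain r :: "nat \<Rightarrow> nat" where r: "strict_mono r" "incseq (\<lambda>n. a (Suc (r n)))"
    using well_ordered_incseq_subseq[OF S, of "\<lambda>n. a (Suc n)"] aS by auto
  \<comment> \<open>The successor ensures that \<open>w (t 0)\<close> was chosen as shortest below
    \<open>w (r 0)\<close>; its tail \<open>v (t 0)\<close> will be a shorter candidate.\<close>
  define t where "t n = Suc (r n)" for n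
  have "sum_list (v (t (Suc n))) < sum_list (v (t n))" for n
  proof (rule ccontr)
    assume "\<not> ?thesis"
    then have "sum_list (w (t n)) \<le> sum_list (w (t (Suc n)))"
      using r(2) by (auto simp: av t_def incseq_def intro!: add_le_mono_both)
    moreover have "t n < t (Suc n)" using r(1) by (simp add: t_def strict_mono_def)
    ultimately show False using desc by (meson not_le)
  qed
  then have "bad (v (t 0))"
    unfolding bad_def using vS by (intro conjI exI[of _ "\<lambda>n. sum_list (v (t n))"]) auto
  moreover have "sum_list (v (t 0)) < sum_list (w (t 0))"
    using add_less_right[of 0 "a (t 0)" "sum_list (v (t 0))"] pos[OF aS] by (simp add: av)
  then have "sum_list (v (t 0)) < sum_list (w (r 0))"
    using desc[of "r 0" "t 0"] by (simp add: t_def)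
  ultimately have "length (w (t 0)) \<le> length (v (t 0))"
    using w(2)[of "r 0"] by (auto simp: next_min_def t_def)
  then show False by (simp add: av)
qed

section \<open>Twisted Malcev-Neumann series\<close>

text \<open>\<open>twist\<close> is a normalized 2-cocycle with nonzero complex values; its identity
  is what associativity of products of monomials requires.\<close>

class twisted_group = bi_ordered_group +
  fixes twist :: "'a \<Rightarrow> 'a \<Rightarrow> complex"
  assumes twist_0_left [simp]: "twist 0 a = 1"
    and twist_0_right [simp]: "twist a 0 = 1"
    and twist_nonzero [simp]: "twist a b \<noteq> 0"
    and twist_cocycle: "twist a b * twist (a + b) c = twist a (b + c) * twist b c"

definition support :: "('a \<Rightarrow> complex) \<Rightarrow> 'a set" where
  "support f = {a. f a \<noteq> 0}"

definition convolution ::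
  "('a::twisted_group \<Rightarrow> complex) \<Rightarrow> ('a \<Rightarrow> complex) \<Rightarrow> 'a \<Rightarrow> complex" where
  "convolution f g c =
     (\<Sum>(a, b)\<in>decompositions (support f) (support g) c. twist a b * f a * g b)"

text \<open>Pairs outside the supports contribute zero, so several convolutions can be compared over
  one finite index set.\<close>

lemma convolution_superset:
  assumes "finite P" "decompositions (support f) (support g) c \<subseteq> P"
    and "\<And>a b. (a, b) \<in> P \<Longrightarrow> a + b = c"
  shows "convolution f g c = (\<Sum>(a, b)\<in>P. twist a b * f a * g b)"
  unfolding convolution_def using assms
  by (intro sum.mono_neutral_left) (auto simp: decompositions_def support_def)

lemma support_convolution: "support (convolution f g) \<subseteq> sumset (support f) (support g)"
proof
  fix c assume "c \<in> support (convolution f g)"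
  then have "decompositions (support f) (support g) c \<noteq> {}"
    by (auto simp: support_def convolution_def)
  then show "c \<in> sumset (support f) (support g)" by (auto simp: decompositions_def sumset_def)
qed

text \<open>Both sides are sums over triples \<open>(a, b, e)\<close> with
  \<open>a + b + e = c\<close>, and the cocycle identity matches their coefficients.\<close>

lemma convolution_assoc:
  assumes f: "well_ordered (support f)" and g: "well_ordered (support g)" and h: "well_ordered (support h)"
  shows "convolution (convolution f g) h = convolution f (convolution g h)"
proof
  fix c
  let ?F = "support f" and ?G = "support g" and ?H = "support h"
  \<comment> \<open>The sumset stands in for the support of the inner convolution, which
    cancellation may make smaller.\<close>
  define P where "P = decompositions (sumset ?F ?G) ?H c"
  define Q where "Q = decompositions ?F (sumset ?G ?H) c"
  have fin: "finite P" "finite Q" "finite (decompositions ?F ?G e)" "finite (decompositions ?G ?H e)" for e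
    using assms by (auto simp: P_def Q_def intro!: finite_decompositions well_ordered_sumset)
  have "convolution (convolution f g) h c = (\<Sum>(d, e)\<in>P. twist d e * convolution f g d * h e)"
    using support_convolution[of f g] fin(1)
    by (intro convolution_superset) (auto simp: P_def decompositions_def)
  also have "\<dots> = (\<Sum>p\<in>P. \<Sum>q\<in>decompositions ?F ?G (fst p).
      twist (fst p) (snd p) * (twist (fst q) (snd q) * f (fst q) * g (snd q)) * h (snd p))"
    by (simp add: convolution_def case_prod_unfold sum_distrib_left sum_distrib_right)
  also have "\<dots> = (\<Sum>(p, q)\<in>(SIGMA p:P. decompositions ?F ?G (fst p)).
      twist (fst p) (snd p) * (twist (fst q) (snd q) * f (fst q) * g (snd q)) * h (snd p))"
    using fin by (intro sum.Sigma) auto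
  also have "\<dots> = (\<Sum>(p, q)\<in>(SIGMA p:Q. decompositions ?G ?H (snd p)).
      twist (fst p) (snd p) * f (fst p) * (twist (fst q) (snd q) * g (fst q) * h (snd q)))"
  proof (rule sum.reindex_bij_witness[where i = "\<lambda>((a, d), (b, e)). ((a + b, e), (a, b))"
        and j = "\<lambda>((d, e), (a, b)). ((a, b + e), (b, e))"], goal_cases)
    case (5 z)
    then obtain a b e where z: "z = ((a + b, e), (a, b))" by (auto simp: decompositions_def)
    have "twist a (b + e) * twist b e * (f a * g b * h e) =
      twist a b * twist (a + b) e * (f a * g b * h e)"
      by (simp add: twist_cocycle)
    then show ?case by (simp add: z mult_ac)
  qed (auto simp: P_def Q_def decompositions_def sumset_def add.assoc, metis add.assoc)
  also have "\<dots> = (\<Sum>p\<in>Q. \<Sum>q\<in>decompositions ?G ?H (snd p).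
      twist (fst p) (snd p) * f (fst p) * (twist (fst q) (snd q) * g (fst q) * h (snd q)))"
    using fin by (intro sum.Sigma[symmetric]) auto
  also have "\<dots> = (\<Sum>(a, d)\<in>Q. twist a d * f a * convolution g h d)"
    by (simp add: convolution_def case_prod_unfold sum_distrib_left sum_distrib_right)
  also have "\<dots> = convolution f (convolution g h) c"
    using support_convolution[of g h] fin(2)
    by (intro convolution_superset[symmetric]) (auto simp: Q_def decompositions_def)
  finally show "convolution (convolution f g) h c = convolution f (convolution g h) c" .
qed

lemma convolution_add_left:
  assumes "well_ordered (support f)" "well_ordered (support g)" "well_ordered (support h)"
  shows "convolution (\<lambda>a. f a + g a) h c = convolution f h c + convolution g h c"
proof -
  let ?P = "decompositions (support f \<union> support g) (support h) c"
  have fin: "finite ?P" using assms by (intro finite_decompositions well_ordered_Un)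
  have eq: "convolution k h c = (\<Sum>(a, b)\<in>?P. twist a b * k a * h b)"
    if "support k \<subseteq> support f \<union> support g" for k
    using that by (intro convolution_superset fin) (auto simp: decompositions_def)
  show ?thesis
    by (subst (1 2 3) eq) (auto simp: support_def case_prod_unfold algebra_simps simp flip: sum.distrib)
qed

lemma convolution_add_right:
  assumes "well_ordered (support f)" "well_ordered (support g)" "well_ordered (support h)"
  shows "convolution h (\<lambda>a. f a + g a) c = convolution h f c + convolution h g c"
proof -
  let ?P = "decompositions (support h) (support f \<union> support g) c"
  have fin: "finite ?P" using assms by (intro finite_decompositions well_ordered_Un)
  have eq: "convolution h k c = (\<Sum>(a, b)\<in>?P. twist a b * h a * k b)"
    if "support k \<subseteq> support f \<union> support g" for k
    using that by (intro convolution_superset fin) (auto simp: decompositions_def)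
  show ?thesis
    by (subst (1 2 3) eq) (auto simp: support_def case_prod_unfold algebra_simps simp flip: sum.distrib)
qed

lemma convolution_monomial_left:
  "convolution (\<lambda>a. if a = d then k else 0) f c = twist d (- d + c) * k * f (- d + c)"
  by (subst convolution_superset[of "{(d, - d + c)}"])
    (auto simp: decompositions_def support_def add.assoc[symmetric] split: if_splits)

lemma convolution_monomial_right:
  "convolution f (\<lambda>a. if a = d then k else 0) c = twist (c - d) d * f (c - d) * k"
  by (subst convolution_superset[of "{(c - d, d)}"])
    (auto simp: decompositions_def support_def split: if_splits)

text \<open>Since \<open>h = 1 - \<epsilon>\<close> with \<open>\<epsilon>\<close> of positive support, \<open>g = 1 + \<epsilon> g\<close> determines \<open>g\<close> by
  recursion on the monoid generated by the support of \<open>\<epsilon>\<close>.\<close>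

lemma convolution_right_inverse_unipotent:
  fixes h :: "'a::twisted_group \<Rightarrow> complex"
  assumes h: "well_ordered (support h)" and h0: "h 0 = 1" and nonneg: "\<And>a. a \<in> support h \<Longrightarrow> 0 \<le> a"
  obtains g where "well_ordered (support g)" "convolution h g = (\<lambda>a. if a = 0 then 1 else 0)"
proof -
  define S where "S = support h - {0}"
  define M where "M = sum_list ` lists S"
  have S: "well_ordered S" "\<And>a. a \<in> S \<Longrightarrow> 0 < a"
    using h nonneg by (auto simp: S_def order.strict_iff_order intro: well_ordered_subset)
  have M: "well_ordered M" unfolding M_def using S by (rule well_ordered_sum_lists)
  have zero_M: "0 \<in> M" unfolding M_def by (rule image_eqI[of _ _ "[]"]) auto
  have add_M: "a + b \<in> M" if "a \<in> S" "b \<in> M" for a b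
  proof -
    from that obtain v where "v \<in> lists S" "b = sum_list v" by (auto simp: M_def)
    then show ?thesis using that unfolding M_def by (intro image_eqI[of _ _ "a # v"]) auto
  qed
  define less_M where "less_M = {(b, c). b \<in> M \<and> c \<in> M \<and> b < c}"
  have wf: "wf less_M"
    unfolding wf_iff_no_infinite_down_chain less_M_def
    using well_ordered_no_descending[OF M] by fastforce
  define T where "T c = decompositions S M c" for c
  have finT: "finite (T c)" for c unfolding T_def using S M by (intro finite_decompositions)
  \<comment> \<open>The equation at \<open>c\<close> for \<open>h\<close> times \<open>g\<close> to
    be 1, solved for \<open>g c\<close> by means of \<open>h 0 = 1\<close>.\<close>
  define step where "step g c = (if c = 0 then 1 else 0) - (\<Sum>(a, b)\<in>T c. twist a b * h a * g b)" for g c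
  define rec where "rec = wfrec less_M step"
  define g where "g c = (if c \<in> M then rec c else 0)" for c
  have g_eq: "g c = (if c = 0 then 1 else 0) - (\<Sum>(a, b)\<in>T c. twist a b * h a * g b)" for c
  proof (cases "c \<in> M")
    case True
    have "b < c \<and> b \<in> M" if "(a, b) \<in> T c" for a b
      using that S(2)[of a] add_less_right[of 0 a b] by (auto simp: T_def decompositions_def)
    then have "(\<Sum>(a, b)\<in>T c. twist a b * h a * cut rec less_M c b) = (\<Sum>(a, b)\<in>T c. twist a b * h a * g b)"
      using True by (intro sum.cong) (auto simp: cut_def less_M_def g_def)
    moreover have "rec c = step (cut rec less_M c) c" unfolding rec_def by (rule wfrec[OF wf])
    ultimately show ?thesis using True by (simp add: g_def step_def)
  next
    case False
    \<comment> \<open>\<open>M\<close> contains 0 and is closed under adding elements of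
      \<open>S\<close>, so outside \<open>M\<close> the equation reads \<open>0 = 0\<close>.\<close>
    then have "T c = {}" using add_M by (auto simp: T_def decompositions_def)
    then show ?thesis using False zero_M by (auto simp: g_def)
  qed
  have supp_g: "support g \<subseteq> M" by (auto simp: support_def g_def)
  have "convolution h g c = (if c = 0 then 1 else 0)" for c
  proof -
    \<comment> \<open>The pair \<open>(0, c)\<close> restores the exponent 0 that was removed from
      \<open>S\<close>.\<close>
    have "convolution h g c = (\<Sum>(a, b)\<in>insert (0, c) (T c). twist a b * h a * g b)"
      using finT supp_g by (intro convolution_superset) (auto simp: T_def S_def decompositions_def)
    also have "\<dots> = g c + (\<Sum>(a, b)\<in>T c. twist a b * h a * g b)"
      using finT h0 by (subst sum.insert) (auto simp: T_def S_def decompositions_def)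
    finally show ?thesis using g_eq[of c] by simp
  qed
  then show thesis using that[of g] well_ordered_subset[OF M supp_g] by blast
qed

text \<open>Multiplying on the right by a monomial moves the least exponent to 0 with coefficient 1,
  which is the unipotent case.\<close>

lemma convolution_right_inverse:
  fixes f :: "'a::twisted_group \<Rightarrow> complex"
  assumes f: "well_ordered (support f)" and "support f \<noteq> {}"
  obtains g where "well_ordered (support g)" "convolution f g = (\<lambda>a. if a = 0 then 1 else 0)"
proof -
  obtain m where m: "m \<in> support f" "\<And>a. a \<in> support f \<Longrightarrow> m \<le> a"
    using well_ordered_min[OF assms] by blast
  \<comment> \<open>A right inverse of the leading monomial of \<open>f\<close>.\<close>
  define k where "k = (\<lambda>a. if a = - m then 1 / (twist m (- m) * f m) else 0)"
  have k: "well_ordered (support k)"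
    by (rule well_ordered_finite) (auto simp: support_def k_def intro: finite_subset[of _ "{- m}"])
  define h where "h = convolution f k"
  have h_eq: "h c = twist (c + m) (- m) * f (c + m) * (1 / (twist m (- m) * f m))" for c
    unfolding h_def k_def by (subst convolution_monomial_right) simp
  have "well_ordered (support h)"
    unfolding h_def by (rule well_ordered_subset[OF well_ordered_sumset[OF f k] support_convolution])
  moreover have "h 0 = 1" using m by (simp add: h_eq support_def)
  moreover have "0 \<le> a" if "a \<in> support h" for a
  proof -
    have "m \<le> a + m" using that m(2)[of "a + m"] by (auto simp: support_def h_eq)
    then have "m + - m \<le> a + m + - m" by (rule add_le_mono_both) simp
    then show ?thesis by simp
  qed
  ultimately obtain g where g: "well_ordered (support g)" "convolution h g = (\<lambda>a. if a = 0 then 1 else 0)"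
    using convolution_right_inverse_unipotent[of h] by blast
  have "convolution f (convolution k g) = (\<lambda>a. if a = 0 then 1 else 0)"
    using g(2) by (simp add: h_def convolution_assoc f k g(1))
  moreover have "well_ordered (support (convolution k g))"
    by (rule well_ordered_subset[OF well_ordered_sumset[OF k g(1)] support_convolution])
  ultimately show thesis using that by blast
qed

section \<open>The division ring of series\<close>

typedef (overloaded) 'a twisted_series = "{f :: 'a::linorder \<Rightarrow> complex. well_ordered (support f)}"
  morphisms series_coeff Abs_series
  by (rule exI[of _ "\<lambda>_. 0"]) (simp add: support_def well_ordered_def)

lemma well_ordered_support_coeff [simp]: "well_ordered (support (series_coeff f))"
  using series_coeff[of f] by simp

setup_lifting type_definition_twisted_series

lemma support_add: "support (\<lambda>a. f a + g a) \<subseteq> support f \<union> support g"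
  by (auto simp: support_def)

lift_definition monomial :: "'a::linorder \<Rightarrow> complex \<Rightarrow> 'a twisted_series" is
  "\<lambda>d k a. if a = d then k else 0"
  by (rule well_ordered_finite, rule finite_subset[of _ "{d}" for d]) (auto simp: support_def)

instantiation twisted_series :: (twisted_group) ring_1
begin

lift_definition zero_twisted_series :: "'a twisted_series" is "\<lambda>_. 0"
  by (simp add: support_def well_ordered_def)

lift_definition one_twisted_series :: "'a twisted_series" is "\<lambda>a. if a = 0 then 1 else 0"
  by (rule well_ordered_finite) (simp add: support_def)

lift_definition plus_twisted_series :: "'a twisted_series \<Rightarrow> 'a twisted_series \<Rightarrow> 'a twisted_series"
  is "\<lambda>f g a. f a + g a"
  by (rule well_ordered_subset[OF well_ordered_Un support_add])

lift_definition uminus_twisted_series :: "'a twisted_series \<Rightarrow> 'a twisted_series" is "\<lambda>f a. - f a"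
  by (simp add: support_def)

lift_definition minus_twisted_series :: "'a twisted_series \<Rightarrow> 'a twisted_series \<Rightarrow> 'a twisted_series"
  is "\<lambda>f g a. f a - g a"
  by (erule well_ordered_subset[OF well_ordered_Un]) (auto simp: support_def)

lift_definition times_twisted_series :: "'a twisted_series \<Rightarrow> 'a twisted_series \<Rightarrow> 'a twisted_series"
  is convolution
  by (rule well_ordered_subset[OF well_ordered_sumset support_convolution])

instance
proof
  fix f g h :: "'a twisted_series"
  show "f * g * h = f * (g * h)" by transfer (rule convolution_assoc)
  show "(f + g) * h = f * h + g * h" by transfer (simp add: fun_eq_iff convolution_add_left)
  show "f * (g + h) = f * g + f * h" by transfer (simp add: fun_eq_iff convolution_add_right)
  show "1 * f = f" by transfer (simp add: fun_eq_iff convolution_monomial_left)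
  show "f * 1 = f" by transfer (simp add: fun_eq_iff convolution_monomial_right)
  show "(0 :: 'a twisted_series) \<noteq> 1" by transfer (auto simp: fun_eq_iff)
qed (transfer; simp add: fun_eq_iff)+

end

lemma twisted_series_right_inverse:
  fixes f :: "'a::twisted_group twisted_series"
  assumes "f \<noteq> 0"
  shows "\<exists>g. f * g = 1"
  using assms
proof transfer
  fix f :: "'a \<Rightarrow> complex"
  assume "well_ordered (support f)" "f \<noteq> (\<lambda>_. 0)"
  then show "\<exists>g\<in>Collect (\<lambda>f. well_ordered (support f)). convolution f g = (\<lambda>a. if a = 0 then 1 else 0)"
    using convolution_right_inverse[of f] by (auto simp: support_def)
qed

instantiation twisted_series :: (twisted_group) division_ring
begin

definition inverse_twisted_series :: "'a twisted_series \<Rightarrow> 'a twisted_series" where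
  "inverse_twisted_series f = (if f = 0 then 0 else SOME g. f * g = 1)"

definition divide_twisted_series :: "'a twisted_series \<Rightarrow> 'a twisted_series \<Rightarrow> 'a twisted_series" where
  "divide_twisted_series f g = f * inverse g"

instance
proof
  fix f g :: "'a twisted_series"
  have right: "h * inverse h = 1" if "h \<noteq> 0" for h :: "'a twisted_series"
    using that someI_ex[OF twisted_series_right_inverse] by (simp add: inverse_twisted_series_def)
  show "f * inverse f = 1" if "f \<noteq> 0" by (rule right[OF that])
  \<comment> \<open>The right inverse of \<open>inverse f\<close> must be \<open>f\<close> itself,
    so right inverses are two-sided.\<close>
  show "inverse f * f = 1" if "f \<noteq> 0"
  proof -
    have 1: "f * inverse f = 1" using that by (rule right)
    then have "inverse f \<noteq> 0" by auto
    then have 2: "inverse f * inverse (inverse f) = 1" by (rule right)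
    then have "f = f * (inverse f * inverse (inverse f))" by simp
    also have "\<dots> = inverse (inverse f)" using 1 by (simp flip: mult.assoc)
    finally show ?thesis using 2 by simp
  qed
qed (simp_all add: inverse_twisted_series_def divide_twisted_series_def)

end

lemma monomial_mult_monomial:
  "monomial a k * monomial b l = monomial (a + b) (twist a b * k * l)"
proof transfer
  fix a b :: 'a and k l
  have "- a + c = b \<longleftrightarrow> c = a + b" for c by (metis add.assoc add.right_inverse add_0 left_minus)
  then show "convolution (\<lambda>c. if c = a then k else 0) (\<lambda>c. if c = b then l else 0) =
      (\<lambda>c. if c = a + b then twist a b * k * l else 0)"
    by (auto simp: fun_eq_iff convolution_monomial_left)
qed

section \<open>A division ring with a solution\<close>

text \<open>\<open>Exponent n s r\<close> is the exponent of the monomial \<open>e\<^sub>r \<alpha>\<^sub>s \<beta>\<^sup>n\<close>, where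
  \<open>\<alpha>\<^sub>s \<alpha>\<^sub>t = \<alpha>\<^bsub>s+t\<^esub>\<close>, \<open>e\<^sub>r e\<^sub>q = e\<^bsub>r+q\<^esub>\<close>, \<open>\<alpha>\<^sub>s e\<^sub>r = exp (2 \<pi> i s r) e\<^sub>r \<alpha>\<^sub>s\<close>,
  \<open>\<beta> \<alpha>\<^sub>s = \<alpha>\<^bsub>3s/2\<^esub> \<beta>\<close> and \<open>\<beta> e\<^sub>r = e\<^bsub>2r/3\<^esub> \<beta>\<close>. (Think of \<open>\<alpha>\<^sub>s\<close> as a translation of the
  line, of \<open>\<beta>\<close> as a dilation, and of \<open>e\<^sub>r\<close> as multiplication by a character.)\<close>

datatype bs_exponent = Exponent (level: int) (shift_part: real) (char_part: real)

instantiation bs_exponent :: "{group_add, linorder}"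
begin

definition zero_bs_exponent :: bs_exponent where "0 = Exponent 0 0 0"

definition plus_bs_exponent :: "bs_exponent \<Rightarrow> bs_exponent \<Rightarrow> bs_exponent" where
  "a + b = Exponent (level a + level b)
     (shift_part a + (3/2) powi level a * shift_part b)
     (char_part a + char_part b / (3/2) powi level a)"

definition uminus_bs_exponent :: "bs_exponent \<Rightarrow> bs_exponent" where
  "- a = Exponent (- level a) (- (shift_part a / (3/2) powi level a))
     (- ((3/2) powi level a * char_part a))"

definition minus_bs_exponent :: "bs_exponent \<Rightarrow> bs_exponent \<Rightarrow> bs_exponent" where
  "minus_bs_exponent a b = a + - b"

text \<open>Lexicographic with the level first: between elements of equal level, translations only
  add constants and rescale by positive factors, so the order is invariant on both sides.\<close>

definition less_bs_exponent :: "bs_exponent \<Rightarrow> bs_exponent \<Rightarrow> bool" where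
  "a < b \<longleftrightarrow> level a < level b \<or> level a = level b \<and>
     (shift_part a < shift_part b \<or> shift_part a = shift_part b \<and> char_part a < char_part b)"

definition less_eq_bs_exponent :: "bs_exponent \<Rightarrow> bs_exponent \<Rightarrow> bool" where
  "less_eq_bs_exponent a b \<longleftrightarrow> a < b \<or> a = b"

instance
  by standard
    (auto simp: zero_bs_exponent_def plus_bs_exponent_def uminus_bs_exponent_def minus_bs_exponent_def
      less_bs_exponent_def less_eq_bs_exponent_def power_int_add power_int_minus field_simps
      intro: bs_exponent.expand)

end

instantiation bs_exponent :: twisted_group
begin

text \<open>Moving \<open>e_r\<close> of the second factor past \<open>\<beta>^n\<close> of the
  first divides \<open>r\<close> by \<open>(3/2)^n\<close>; moving it on past
  \<open>\<alpha>_s\<close> produces this scalar.\<close>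

definition twist_bs_exponent :: "bs_exponent \<Rightarrow> bs_exponent \<Rightarrow> complex" where
  "twist a b = cis (2 * pi * (shift_part a * char_part b / (3/2) powi level a))"

instance
proof
  fix a b c :: bs_exponent
  show "a < b \<Longrightarrow> c + a < c + b" "a < b \<Longrightarrow> a + c < b + c"
    by (auto simp: less_bs_exponent_def plus_bs_exponent_def intro!: divide_strict_right_mono)
  show "twist 0 a = 1" "twist a 0 = 1" "twist a b \<noteq> 0"
    by (simp_all add: twist_bs_exponent_def zero_bs_exponent_def)
  show "twist a b * twist (a + b) c = twist a (b + c) * twist b c"
    by (simp add: twist_bs_exponent_def plus_bs_exponent_def cis_mult power_int_add power_int_minus
        field_simps)
qed

end

text \<open>In the ring of series, \<open>\<alpha> = monomial (Exponent 0 1 0) 1\<close> and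
  \<open>\<beta> = monomial (Exponent 1 0 0) 1\<close> satisfy \<open>\<beta> \<alpha>\<^sup>2 = \<alpha>\<^sup>3 \<beta>\<close>, but \<open>\<beta> \<alpha> \<beta>\<inverse>\<close> commutes with
  \<open>\<alpha>\<close>. Replacing \<open>\<beta>\<close> by \<open>(1 + \<epsilon>) \<beta>\<close>, where \<open>\<epsilon>\<close> commutes with \<open>\<alpha>\<^sup>3\<close> but not with \<open>\<alpha>\<close>, keeps
  the relation and destroys the commutation.\<close>

lemma baumslag_solitar_pair:
  obtains x y :: "bs_exponent twisted_series"
  where "x \<noteq> 0" "y \<noteq> 0" "y * x^2 = x^3 * y"
    "(y * x * inverse y) * x \<noteq> x * (y * x * inverse y)"
proof -
  define shift where "shift s = monomial (Exponent 0 s 0) 1" for s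
  define \<beta> where "\<beta> = monomial (Exponent 1 0 0) 1"
  \<comment> \<open>With \<open>1/3\<close>, the commutation factor
    \<open>cis (2 * pi * s / 3)\<close> is 1 at \<open>s = 3\<close>, a primitive cube root of unity
    at \<open>s = 1\<close>, and -1 at \<open>s = 3/2\<close>.\<close>
  define eps where "eps k = monomial (Exponent 0 0 (1/3)) k" for k
  define \<omega> where "\<omega> = cis (2 * pi / 3)"
  note defs = shift_def \<beta>_def eps_def monomial_mult_monomial plus_bs_exponent_def twist_bs_exponent_def
  have shift_add: "shift s * shift t = shift (s + t)" for s t by (simp add: defs)
  have \<beta>_shift: "\<beta> * shift s = shift (3/2 * s) * \<beta>" for s by (simp add: defs)
  have shift_eps: "shift s * eps k = eps (cis (2 * pi * s / 3) * k) * shift s" for s k by (simp add: defs)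
  have monomial_nz: "monomial a k \<noteq> (0 :: bs_exponent twisted_series)" if "k \<noteq> 0" for a k
    using that by transfer (auto simp: fun_eq_iff)
  have shift_nz: "shift s \<noteq> 0" for s unfolding shift_def by (rule monomial_nz) simp
  have eps_add: "eps k + eps l = eps (k + l)" for k l unfolding eps_def by transfer auto
  have eps_comm: "eps k * eps l = eps l * eps k" for k l by (simp add: defs mult.commute)
  define p where "p k = 1 + eps k" for k
  have p_nz: "p k \<noteq> 0" for k
  proof -
    have "series_coeff (p k) 0 = 1" unfolding p_def eps_def by transfer (simp add: zero_bs_exponent_def)
    moreover have "series_coeff (0 :: bs_exponent twisted_series) 0 = 0" by transfer simp
    ultimately show ?thesis by auto
  qed
  have p_comm: "p k * p l = p l * p k" for k l by (simp add: p_def algebra_simps eps_comm)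
  have shift_p: "shift s * p k = p (cis (2 * pi * s / 3) * k) * shift s" for s k
    by (simp add: p_def algebra_simps shift_eps)
  define x where "x = shift 1"
  define y where "y = p 1 * \<beta>"
  have y_nz: "y \<noteq> 0" using p_nz by (simp add: y_def \<beta>_def monomial_nz)
  have x2: "x^2 = shift 2" and x3: "x^3 = shift 3"
    by (simp_all add: x_def power2_eq_square power3_eq_cube shift_add)
  have "y * x^2 = p 1 * (shift 3 * \<beta>)" by (simp add: x2 y_def mult.assoc \<beta>_shift)
  also have "\<dots> = shift 3 * p 1 * \<beta>" by (simp add: shift_p mult.assoc)
  finally have rel: "y * x^2 = x^3 * y" by (simp add: x3 y_def mult.assoc)

  define u where "u = y * x * inverse y"
  have uy: "u * y = y * x" using y_nz by (simp add: u_def mult.assoc)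
  have "y * x = p 1 * shift (3/2) * \<beta>" by (simp add: y_def x_def mult.assoc \<beta>_shift)
  then have "u * p 1 * \<beta> = p 1 * shift (3/2) * \<beta>" using uy by (simp add: y_def mult.assoc)
  then have up: "u * p 1 = p 1 * shift (3/2)" by (simp add: \<beta>_def monomial_nz)
  have half: "shift (3/2) * p k = p (- k) * shift (3/2)" for k using shift_p[of "3/2" k] by simp
  have "u * x \<noteq> x * u"
  proof
    assume comm: "u * x = x * u"
    \<comment> \<open>\<open>u\<close> is the conjugate of \<open>shift (3/2)\<close> by
      \<open>p 1\<close>. Moving \<open>shift (3/2)\<close> past the inverse of \<open>p 1\<close>
      turns that inverse into \<open>q\<close>, whence
      \<open>u = p 1 * q * shift (3/2)\<close>.\<close>
    define q where "q = inverse (p (- 1))"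
    have q: "q * p (- 1) = 1" "p (- 1) * q = 1" using p_nz by (simp_all add: q_def)
    have q_comm: "q * p k = p k * q" for k
    proof -
      have "q * p k = q * (p k * p (- 1)) * q" using q by (simp add: mult.assoc)
      also have "\<dots> = q * p (- 1) * p k * q" by (simp add: p_comm mult.assoc)
      finally show ?thesis using q by simp
    qed
    have "p 1 * q * shift (3/2) * p 1 = p 1 * (q * p (- 1)) * shift (3/2)"
      by (simp add: mult.assoc half)
    then have "u * p 1 = p 1 * q * shift (3/2) * p 1" using up q by simp
    then have u: "u = p 1 * q * shift (3/2)" using p_nz by simp
    have "u * x * p 1 = p 1 * q * (shift (3/2) * p \<omega>) * x"
      using shift_p[of 1 1] by (simp add: u x_def mult.assoc \<omega>_def)
    also have "\<dots> = p 1 * q * p (- \<omega>) * shift (5/2)" by (simp add: half mult.assoc x_def shift_add)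
    finally have 1: "u * x * p 1 = p 1 * q * p (- \<omega>) * shift (5/2)" .
    have "x * u * p 1 = (x * p 1) * shift (3/2)" by (simp add: up mult.assoc)
    also have "\<dots> = p \<omega> * shift (5/2)"
      using shift_p[of 1 1] by (simp add: x_def \<omega>_def mult.assoc shift_add)
    finally have "p 1 * q * p (- \<omega>) = p \<omega>" using 1 comm shift_nz by simp
    then have "p 1 * p (- \<omega>) * q * p (- 1) = p \<omega> * p (- 1)" by (simp add: mult.assoc q_comm)
    then have "p 1 * p (- \<omega>) = p \<omega> * p (- 1)" using q by (simp add: mult.assoc)
    \<comment> \<open>With \<open>\<epsilon> = eps 1\<close>, the equation is \<open>(1 +
      \<epsilon>)(1 - \<omega>\<epsilon>) = (1 + \<omega>\<epsilon>)(1 - \<epsilon>)\<close>. The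
      quadratic terms agree, and the linear ones would force \<open>\<omega> = 1\<close>.\<close>
    moreover have "eps 1 * eps (- \<omega>) = eps \<omega> * eps (- 1)" by (simp add: defs)
    ultimately have "eps (1 - \<omega>) = eps (\<omega> - 1)"
      using eps_add[of 1 "- \<omega>"] eps_add[of \<omega> "- 1"] by (simp add: p_def algebra_simps)
    then have "series_coeff (eps (1 - \<omega>)) (Exponent 0 0 (1/3)) = series_coeff (eps (\<omega> - 1)) (Exponent 0 0 (1/3))"
      by simp
    then have "1 - \<omega> = \<omega> - 1" unfolding eps_def by transfer simp
    then have "Re \<omega> = 1" by (simp add: complex_eq_iff)
    then show False by (simp add: \<omega>_def cos_120)
  qed
  then show thesis using that[of x y] shift_nz y_nz rel by (simp add: u_def x_def)
qed

section \<open>Countable division subrings and transport of structure\<close>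

text \<open>Expressions in two generators indexed by \<open>bool\<close>; their countability passes
  to the division subring that they describe.\<close>

datatype skew_term = Var bool | Zero | One | Add skew_term skew_term | Neg skew_term
  | Mult skew_term skew_term | Inv skew_term

instance skew_term :: countable by countable_datatype

primrec skew_eval :: "(bool \<Rightarrow> 'a::division_ring) \<Rightarrow> skew_term \<Rightarrow> 'a" where
  "skew_eval \<rho> (Var i) = \<rho> i"
| "skew_eval \<rho> Zero = 0"
| "skew_eval \<rho> One = 1"
| "skew_eval \<rho> (Add s t) = skew_eval \<rho> s + skew_eval \<rho> t"
| "skew_eval \<rho> (Neg s) = - skew_eval \<rho> s"
| "skew_eval \<rho> (Mult s t) = skew_eval \<rho> s * skew_eval \<rho> t"
| "skew_eval \<rho> (Inv s) = inverse (skew_eval \<rho> s)"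

definition transported_ring :: "'a::ring_1 set \<Rightarrow> ('a \<Rightarrow> 'b) \<Rightarrow> ('b \<Rightarrow> 'a) \<Rightarrow> 'b ring" where
  "transported_ring S \<phi> \<psi> = \<lparr>carrier = \<phi> ` S, mult = (\<lambda>a b. \<phi> (\<psi> a * \<psi> b)), one = \<phi> 1,
     zero = \<phi> 0, add = (\<lambda>a b. \<phi> (\<psi> a + \<psi> b))\<rparr>"

context
  fixes S :: "'a::division_ring set" and \<phi> :: "'a \<Rightarrow> 'b" and \<psi> :: "'b \<Rightarrow> 'a"
  assumes inv: "\<And>a. a \<in> S \<Longrightarrow> \<psi> (\<phi> a) = a"
    and closed: "0 \<in> S" "1 \<in> S" "\<And>a b. a \<in> S \<Longrightarrow> b \<in> S \<Longrightarrow> a + b \<in> S" "\<And>a. a \<in> S \<Longrightarrow> - a \<in> S"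
      "\<And>a b. a \<in> S \<Longrightarrow> b \<in> S \<Longrightarrow> a * b \<in> S" "\<And>a. a \<in> S \<Longrightarrow> inverse a \<in> S"
begin

lemma ring_transported: "ring (transported_ring S \<phi> \<psi>)"
proof (rule ringI)
  show "abelian_group (transported_ring S \<phi> \<psi>)"
  proof (rule abelian_groupI)
    fix a assume "a \<in> carrier (transported_ring S \<phi> \<psi>)"
    then obtain s where "s \<in> S" "a = \<phi> s" by (auto simp: transported_ring_def)
    then show "\<exists>b\<in>carrier (transported_ring S \<phi> \<psi>).
        b \<oplus>\<^bsub>transported_ring S \<phi> \<psi>\<^esub> a = \<zero>\<^bsub>transported_ring S \<phi> \<psi>\<^esub>"
      by (intro bexI[of _ "\<phi> (- s)"]) (auto simp: transported_ring_def inv closed)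
  qed (auto simp: transported_ring_def inv closed ac_simps)
  show "Group.monoid (transported_ring S \<phi> \<psi>)"
    by (rule monoidI) (auto simp: transported_ring_def inv closed mult.assoc)
qed (auto simp: transported_ring_def inv closed algebra_simps)

lemma skew_field_transported: "skew_field (transported_ring S \<phi> \<psi>)"
proof -
  let ?R = "transported_ring S \<phi> \<psi>"
  interpret ring ?R by (rule ring_transported)
  show ?thesis
  proof
    have "\<phi> 1 \<noteq> \<phi> 0" using inv[of 0] inv[of 1] closed by auto
    then show "\<one>\<^bsub>?R\<^esub> \<noteq> \<zero>\<^bsub>?R\<^esub>" by (simp add: transported_ring_def)
    show "Units ?R = carrier ?R - {\<zero>\<^bsub>?R\<^esub>}"
    proof (intro equalityI subsetI)
      fix a assume "a \<in> Units ?R"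
      then show "a \<in> carrier ?R - {\<zero>\<^bsub>?R\<^esub>}"
        using \<open>\<phi> 1 \<noteq> \<phi> 0\<close> by (auto simp: Units_def transported_ring_def inv closed)
    next
      fix a assume a: "a \<in> carrier ?R - {\<zero>\<^bsub>?R\<^esub>}"
      then obtain s where s: "s \<in> S" "a = \<phi> s" by (auto simp: transported_ring_def)
      with a have "s \<noteq> 0" by (auto simp: transported_ring_def)
      with s show "a \<in> Units ?R"
        unfolding Units_def
        by (auto simp: transported_ring_def inv closed intro!: bexI[of _ "inverse s"])
    qed
  qed
qed

lemma transported_minus:
  assumes "a \<in> S" "b \<in> S"
  shows "\<phi> a \<ominus>\<^bsub>transported_ring S \<phi> \<psi>\<^esub> \<phi> b = \<phi> (a - b)"
proof -
  interpret ring "transported_ring S \<phi> \<psi>" by (rule ring_transported)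
  have "\<ominus>\<^bsub>transported_ring S \<phi> \<psi>\<^esub> \<phi> b = \<phi> (- b)"
    using assms by (intro minus_equality) (auto simp: transported_ring_def inv closed)
  then show ?thesis using assms by (simp add: a_minus_def) (simp add: transported_ring_def inv closed)
qed

text \<open>If the word \<open>w\<close> were 1, then \<open>y * x * inverse y\<close> would commute
  with \<open>x\<close>; hence \<open>w - 1\<close> is nonzero and its inverse serves as
  \<open>z\<close>.\<close>

lemma bs_solution_transported:
  assumes S: "x \<in> S" "y \<in> S" and nz: "x \<noteq> 0" "y \<noteq> 0" and rel: "y * x^2 = x^3 * y"
    and noncomm: "(y * x * inverse y) * x \<noteq> x * (y * x * inverse y)"
  shows "\<exists>x x' y y' z. bs_solution (transported_ring S \<phi> \<psi>) x x' y y' z"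
proof -
  let ?R = "transported_ring S \<phi> \<psi>"
  let ?x' = "inverse x" and ?y' = "inverse y"
  define w where "w = y * x * ?y' * ?x' * y * ?x' * ?y' * x"
  have mult: "\<phi> a \<otimes>\<^bsub>?R\<^esub> \<phi> b = \<phi> (a * b)" if "a \<in> S" "b \<in> S" for a b
    using that by (simp add: transported_ring_def inv)
  have one: "\<one>\<^bsub>?R\<^esub> = \<phi> 1" by (simp add: transported_ring_def)
  have "w - 1 \<noteq> 0"
  proof
    assume "w - 1 = 0"
    define u where "u = y * x * ?y'"
    define u' where "u' = y * ?x' * ?y'"
    have cancel: "x * (?x' * b) = b" "?x' * (x * b) = b" "?y' * (y * b) = b" for b
      using nz by (simp_all flip: mult.assoc)
    have "u' * u = 1" using nz by (simp add: u_def u'_def mult.assoc cancel)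
    have "u * ?x' * (u' * x) = 1" using \<open>w - 1 = 0\<close> by (simp add: w_def u_def u'_def mult.assoc)
    then have "?x' * u = u * ?x' * (u' * x) * (?x' * u)" by simp
    also have "\<dots> = u * ?x'" using \<open>u' * u = 1\<close> by (simp add: mult.assoc cancel)
    finally have "x * (?x' * u) * x = x * (u * ?x') * x" by simp
    then have "u * x = x * u" using nz by (simp add: mult.assoc cancel)
    then show False using noncomm by (simp add: u_def)
  qed
  moreover have "w \<in> S" using S by (simp add: w_def closed)
  moreover have "w - 1 \<in> S" using closed(3)[of w "- 1"] \<open>w \<in> S\<close> by (simp add: closed)
  moreover have "y * x^2 * ?y' = x^3" using rel nz by (simp add: mult.assoc)
  then have "y * (x * x) * ?y' = x * x * x" by (simp add: power2_eq_square power3_eq_cube)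
  ultimately have "bs_solution ?R (\<phi> x) (\<phi> ?x') (\<phi> y) (\<phi> ?y') (\<phi> (inverse (w - 1)))"
    unfolding bs_solution_def using S nz
    by (simp add: numeral_2_eq_2 numeral_3_eq_3 one mult closed transported_minus flip: w_def)
       (auto simp: transported_ring_def closed)
  then show ?thesis by blast
qed

end

text \<open>The values of all terms in \<open>x\<close> and \<open>y\<close> form a countable set
  closed under the division ring operations, which \<open>to_nat_on\<close> codes by natural
  numbers.\<close>

theorem exists_solution_skew_field:
  "\<exists>D :: nat ring. skew_field D \<and> (\<exists>x x' y y' z. bs_solution D x x' y y' z)"
proof -
  obtain x y :: "bs_exponent twisted_series"
    where xy: "x \<noteq> 0" "y \<noteq> 0" "y * x^2 = x^3 * y"
      "(y * x * inverse y) * x \<noteq> x * (y * x * inverse y)"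
    by (rule baumslag_solitar_pair)
  define eval where "eval = skew_eval (\<lambda>i. if i then x else y)"
  define S where "S = range eval"
  have "countable S" by (simp add: S_def)
  then have inv: "from_nat_into S (to_nat_on S a) = a" if "a \<in> S" for a using that by simp
  have "eval (Var True) = x" "eval (Var False) = y" by (simp_all add: eval_def)
  then have xyS: "x \<in> S" "y \<in> S" unfolding S_def by (metis rangeI)+
  have "eval Zero = 0" "eval One = 1" by (simp_all add: eval_def)
  then have "0 \<in> S" "1 \<in> S" unfolding S_def by (metis rangeI)+
  moreover have "a + b \<in> S \<and> a * b \<in> S" if "a \<in> S" "b \<in> S" for a b
  proof -
    from that obtain s t where "a = eval s" "b = eval t" by (auto simp: S_def)
    then have "a + b = eval (Add s t)" "a * b = eval (Mult s t)" by (simp_all add: eval_def)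
    then show ?thesis by (simp add: S_def)
  qed
  moreover have "- a \<in> S \<and> inverse a \<in> S" if "a \<in> S" for a
  proof -
    from that obtain s where "a = eval s" by (auto simp: S_def)
    then have "- a = eval (Neg s)" "inverse a = eval (Inv s)" by (simp_all add: eval_def)
    then show ?thesis by (simp add: S_def)
  qed
  ultimately show ?thesis
    using skew_field_transported[of S "from_nat_into S" "to_nat_on S"]
      bs_solution_transported[of S "from_nat_into S" "to_nat_on S", OF _ _ _ _ _ _ _ xyS xy] inv
    by blast
qed

theorem theorem6p5:
  shows "(\<exists>D :: nat ring. skew_field D \<and> (\<exists>x x' y y' z. bs_solution D x x' y y' z)) \<and>
    (\<forall>c > 0. \<not> (\<exists>x x' y y' z. bs_solution (ring_mat TYPE('f :: field) c ()) x x' y y' z))"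
  using exists_solution_skew_field no_solution_ring_mat by blast

end
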